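(* For any $n>8$ there exists a permutation $\pi\in S_n$ such that any tangle performing $\pi$ has a path with at least $3$ moves.
   Context: $S_n$ is the symmetric group on $\{1,\ldots,n\}$; a permutation is written $\pi=[\pi(1),\ldots,\pi(n)]$, and $\mathrm{id}=[1,\ldots,n]$. Two permutations $\pi,\rho\in S_n$ are adjacent if $|\pi^{-1}(i)-\rho^{-1}(i)|\le 1$ for every $i\in\{1,\ldots,n\}$ (so equal permutations are adjacent). A tangle is a finite sequence $\pi_1,\ldots,\pi_N$ of permutations in $S_n$ in which each consecutive pair is adjacent. A tangle performs $\pi$ if its first permutation is $\mathrm{id}$ and its last is $\pi$. For an element $i$, path $i$ is the sequence of positions $\pi_1^{-1}(i),\ldots,\pi_N^{-1}(i)$. A move of path $i$ is a maximal subsequence of at least two consecutive permutations of the tangle during which the positions of $i$ form an arithmetic progression of common difference $+1$, or of common difference $-1$. *)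

theory Defs
  imports "HOL-Combinatorics.Permutations"
begin

text \<open>A permutation \<open>\<pi> \<in> S_n\<close> is a function \<open>p\<close> with \<open>p permutes {1..n}\<close>; the element \<open>i\<close> stands at
  position \<open>inv p i\<close>.\<close>

definition position :: "(nat \<Rightarrow> nat) \<Rightarrow> nat \<Rightarrow> int" where
  "position p i = int (inv p i)"

definition adjacent :: "nat \<Rightarrow> (nat \<Rightarrow> nat) \<Rightarrow> (nat \<Rightarrow> nat) \<Rightarrow> bool" where
  "adjacent n p q \<longleftrightarrow> (\<forall>i\<in>{1..n}. \<bar>position p i - position q i\<bar> \<le> 1)"

definition tangle :: "nat \<Rightarrow> (nat \<Rightarrow> nat) list \<Rightarrow> bool" where
  "tangle n T \<longleftrightarrow> T \<noteq> [] \<and> (\<forall>p\<in>set T. p permutes {1..n}) \<and> successively (adjacent n) T"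

definition performs :: "(nat \<Rightarrow> nat) list \<Rightarrow> (nat \<Rightarrow> nat) \<Rightarrow> bool" where
  "performs T p \<longleftrightarrow> T \<noteq> [] \<and> hd T = id \<and> last T = p"

definition path :: "(nat \<Rightarrow> nat) list \<Rightarrow> nat \<Rightarrow> int list" where
  "path T i = map (\<lambda>p. position p i) T"

text \<open>The block of consecutive entries with (0-based, inclusive) indices \<open>a, \<dots>, b\<close> has at least two
  entries and is an arithmetic progression of common difference \<open>1\<close> or \<open>-1\<close>.\<close>

definition unit_progression :: "int list \<Rightarrow> nat \<Rightarrow> nat \<Rightarrow> bool" where
  "unit_progression xs a b \<longleftrightarrow> a < b \<and> b < length xs \<and>
     (\<exists>d\<in>{1, -1}. \<forall>k\<in>{a..b}. xs ! k = xs ! a + d * (int k - int a))"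

text \<open>Moves are identified with their index ranges. Two successive moves in opposite directions may
  share an endpoint.\<close>

definition is_move :: "int list \<Rightarrow> nat \<Rightarrow> nat \<Rightarrow> bool" where
  "is_move xs a b \<longleftrightarrow> unit_progression xs a b \<and>
     (\<forall>a' b'. unit_progression xs a' b' \<and> {a..b} \<subseteq> {a'..b'} \<longrightarrow> a' = a \<and> b' = b)"

definition moves :: "int list \<Rightarrow> (nat \<times> nat) set" where
  "moves xs = {(a, b). is_move xs a b}"

lemma finite_moves: "finite (moves xs)"
proof (rule finite_subset)
  show "moves xs \<subseteq> {..<length xs} \<times> {..<length xs}"
    by (auto simp: moves_def is_move_def unit_progression_def)
qed simp

end

theory Submission
  imports Defs
begin

text \<open>The obstruction is \<open>[n, 3, 2, n - 3, \<dots>, 4, n - 1, n - 2, 1]\<close>. Suppose that every path has at most two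
  moves. Then paths \<open>1\<close> and \<open>n\<close> are monotone. Every other path crosses \<open>1\<close> going left and \<open>n\<close> going right,
  so it consists of exactly one uninterrupted left move and one uninterrupted right move, and is either
  left-first or right-first. If \<open>x\<close> and \<open>y\<close> are left-first and inverted, no left-first \<open>f\<close> can start and
  end to the right of their block: right after crossing \<open>1\<close>, \<open>y\<close> crosses some \<open>u\<close>, which from then on
  moves right without pause up to \<open>n\<close>, following \<open>1\<close> so closely that it runs into \<open>f\<close> just after \<open>1\<close> has
  crossed \<open>f\<close>. The mirror image holds for right-first paths. Two of the elements \<open>4\<close>, \<open>5\<close>, \<open>6\<close> have the same
  type; if they are left-first, then \<open>n - 2\<close> and \<open>n - 1\<close> are right-first, hence \<open>2\<close> and \<open>3\<close> are left-first,
  which contradicts the type of \<open>4\<close>, \<open>5\<close>, \<open>6\<close>. The other case is symmetric.\<close>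

section \<open>Adjacent permutations and moves\<close>

text \<open>The preimage of \<open>k\<close> is \<open>k - 1\<close>, \<open>k\<close> or
  \<open>k + 1\<close>. It is not \<open>k\<close>, and if it were \<open>k - 1\<close>, induction
  would give \<open>\<sigma> k = k - 1\<close>.\<close>

lemma displacement_le_1_swap:
  fixes \<sigma> :: "nat \<Rightarrow> nat"
  assumes "bij \<sigma>" and le: "\<And>k. \<bar>int (\<sigma> k) - int k\<bar> \<le> 1" and "\<sigma> k = Suc k"
  shows "\<sigma> (Suc k) = k"
  using \<open>\<sigma> k = Suc k\<close>
proof (induction k)
  case 0
  obtain j where j: "\<sigma> j = 0"
    using \<open>bij \<sigma>\<close> by (metis bij_pointE)
  have "j \<le> 1"
    using le[of j] j by simp
  then show ?case
    using j 0 by (cases j) auto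
next
  case (Suc k)
  obtain j where j: "\<sigma> j = Suc k"
    using \<open>bij \<sigma>\<close> by (metis bij_pointE)
  have "j = k \<or> j = Suc k \<or> j = Suc (Suc k)"
    using le[of j] j by linarith
  moreover have "j \<noteq> k"
    using Suc j by auto
  ultimately show ?case
    using j Suc.prems by auto
qed

lemma position_fixed:
  assumes "p permutes {1..n}" "i \<notin> {1..n}"
  shows "position p i = int i"
  using permutes_not_in[OF permutes_inv[OF assms(1)] assms(2)] by (simp add: position_def)

lemma position_inj:
  assumes "p permutes {1..n}" "position p i = position p j"
  shows "i = j"
  using assms permutes_inj[OF permutes_inv[OF assms(1)]] by (auto simp: position_def dest: injD)

lemma position_bounds:
  assumes "p permutes {1..n}" "i \<in> {1..n}"
  shows "1 \<le> position p i" "position p i \<le> int n"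
  using assms permutes_in_image[OF permutes_inv[OF assms(1)], of i] by (auto simp: position_def)

lemma adjacent_sym: "adjacent n p q \<Longrightarrow> adjacent n q p"
  by (simp add: adjacent_def abs_minus_commute)

lemma adjacent_step:
  assumes "p permutes {1..n}" "q permutes {1..n}" "adjacent n p q"
  shows "\<bar>position q i - position p i\<bar> \<le> 1"
proof (cases "i \<in> {1..n}")
  case True
  then show ?thesis
    using assms(3) by (simp add: adjacent_def abs_minus_commute)
next
  case False
  then show ?thesis
    by (simp add: position_fixed[OF assms(1)] position_fixed[OF assms(2)])
qed

lemma adjacent_swap:
  assumes pq: "p permutes {1..n}" "q permutes {1..n}" "adjacent n p q"
    and right: "position q i = position p i + 1"
  obtains j where "position p j = position p i + 1" "position q j = position p i"
proof -
  \<comment> \<open>\<open>?\<sigma>\<close> sends the position of an element in \<open>p\<close> to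
    its position in \<open>q\<close>.\<close>
  let ?\<sigma> = "inv q \<circ> p"
  have inv_p: "inv p (p k) = k" for k
    using pq(1) by (metis permutes_inverses(2))
  have p_inv: "p (inv p k) = k" for k
    using pq(1) by (metis permutes_inverses(1))
  have "bij ?\<sigma>"
    using pq by (intro bij_comp) (auto intro: permutes_bij permutes_inv)
  moreover have "\<bar>int (?\<sigma> k) - int k\<bar> \<le> 1" for k
    using adjacent_step[OF pq, of "p k"] by (simp add: position_def inv_p)
  moreover have "?\<sigma> (inv p i) = Suc (inv p i)"
    using right by (simp add: position_def p_inv)
  ultimately have "?\<sigma> (Suc (inv p i)) = inv p i"
    by (rule displacement_le_1_swap)
  then show ?thesis
    by (intro that[of "p (Suc (inv p i))"]) (auto simp: position_def inv_p)
qed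

section \<open>Steps and moves of an integer sequence\<close>

text \<open>A longest unit progression through the step at \<open>t\<close> is a move, and this step
  fixes its direction.\<close>

lemma move_through_step:
  assumes t: "Suc t < length xs" and e: "e \<in> {1, -1}" and xs: "xs ! Suc t = xs ! t + e"
  obtains a b where "(a, b) \<in> moves xs" "a \<le> t" "t < b"
    "\<And>k. a \<le> k \<Longrightarrow> k < b \<Longrightarrow> xs ! Suc k = xs ! k + e"
proof -
  define P where "P z \<longleftrightarrow> unit_progression xs (fst z) (snd z) \<and> fst z \<le> t \<and> t < snd z" for z
  define len :: "nat \<times> nat \<Rightarrow> nat" where "len z = snd z - fst z" for z
  have "P (t, Suc t)"
    using assms by (auto simp: P_def unit_progression_def atLeastAtMostSuc_conv)
  moreover have "\<forall>z. P z \<longrightarrow> len z < length xs"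
    by (auto simp: P_def len_def unit_progression_def)
  ultimately have "\<exists>z. P z \<and> (\<forall>y. P y \<longrightarrow> len y \<le> len z)"
    by (rule Lattices_Big.ex_has_greatest_nat)
  then obtain a b where z: "P (a, b)" "\<forall>y. P y \<longrightarrow> len y \<le> len (a, b)"
    by auto
  then have ab: "unit_progression xs a b" "a \<le> t" "t < b"
    by (auto simp: P_def)
  have "is_move xs a b"
    unfolding is_move_def
  proof (intro conjI allI impI ab(1))
    fix a' b' assume *: "unit_progression xs a' b' \<and> {a..b} \<subseteq> {a'..b'}"
    then have "a' \<le> a" "b \<le> b'"
      using ab by auto
    moreover from this have "b' - a' \<le> b - a"
      using z(2)[rule_format, of "(a', b')"] ab * by (auto simp: P_def len_def)
    ultimately show "a' = a" "b' = b"
      using ab by auto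
  qed
  moreover obtain c where c: "\<forall>k\<in>{a..b}. xs ! k = xs ! a + c * (int k - int a)"
    using ab(1) unfolding unit_progression_def by blast
  have step: "xs ! Suc k = xs ! k + c" if "a \<le> k" "k < b" for k
    using that c[rule_format, of k] c[rule_format, of "Suc k"] by (simp add: algebra_simps)
  moreover have "c = e"
    using step[of t] xs ab by simp
  ultimately show ?thesis
    using that[of a b] ab by (auto simp: moves_def)
qed

lemma increasing_step_exists:
  fixes g :: "nat \<Rightarrow> int"
  assumes "\<And>t. \<bar>g (Suc t) - g t\<bar> \<le> 1" "g s < g r" "s \<le> r"
  obtains t where "s \<le> t" "t < r" "g (Suc t) = g t + 1"
proof -
  have "g r \<le> g s" if *: "\<And>t. s \<le> t \<Longrightarrow> t < r \<Longrightarrow> g (Suc t) \<noteq> g t + 1"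
    using \<open>s \<le> r\<close> *
  proof (induction r rule: dec_induct)
    case (step k)
    then have "g k \<le> g s" "g (Suc k) \<noteq> g k + 1"
      by auto
    then show ?case
      using assms(1)[of k] by linarith
  qed simp
  then show ?thesis
    using assms(2) that by force
qed

text \<open>All steps within a move have one direction. A move containing the steps at
  \<open>s\<close> and \<open>r\<close> would also contain the one at \<open>t\<close>, and neither
  of their moves contains the opposite step at \<open>v\<close>.\<close>

lemma three_moves:
  assumes "s < t" "t < r" "Suc r < length xs" "Suc v < length xs" "e \<in> {1, -1}"
    and "xs ! Suc s = xs ! s + e" "xs ! Suc t \<noteq> xs ! t + e" "xs ! Suc r = xs ! r + e"
    and "xs ! Suc v = xs ! v - e"
  shows "card (moves xs) \<ge> 3"
proof -
  obtain a b where ab: "(a, b) \<in> moves xs" "a \<le> s" "s < b"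
    "\<And>k. a \<le> k \<Longrightarrow> k < b \<Longrightarrow> xs ! Suc k = xs ! k + e"
    by (rule move_through_step[of s xs e]) (use assms in auto)
  obtain a' b' where ab': "(a', b') \<in> moves xs" "a' \<le> r" "r < b'"
    "\<And>k. a' \<le> k \<Longrightarrow> k < b' \<Longrightarrow> xs ! Suc k = xs ! k + e"
    by (rule move_through_step[of r xs e]) (use assms in auto)
  obtain a'' b'' where ab'': "(a'', b'') \<in> moves xs" "a'' \<le> v" "v < b''"
    by (rule move_through_step[of v xs "-e"]) (use assms in auto)
  have "(a, b) \<noteq> (a', b')"
    using ab(4)[of t] ab' ab assms by auto
  moreover have "(a, b) \<noteq> (a'', b'')" "(a', b') \<noteq> (a'', b'')"
    using ab(4)[of v] ab'(4)[of v] ab'' assms by auto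
  ultimately have "card {(a, b), (a', b'), (a'', b'')} = 3"
    by simp
  then show ?thesis
    using card_mono[OF finite_moves, of "{(a, b), (a', b'), (a'', b'')}" xs] ab ab' ab'' by simp
qed

section \<open>Paths with two moves\<close>

text \<open>\<open>\<alpha>\<close> and \<open>\<beta>\<close> play the roles of the elements \<open>1\<close> and \<open>n\<close>, and \<open>M\<close> that of \<open>{2..n - 1}\<close>. Paths are extended
  to be constant after time \<open>N\<close>, so that no axiom needs a bound on time, and positions are arbitrary
  integers, so that the mirror image is just negation with \<open>\<alpha>\<close> and \<open>\<beta>\<close> exchanged.\<close>

locale two_move_paths =
  fixes X :: "'a \<Rightarrow> nat \<Rightarrow> int" and N :: nat and M :: "'a set" and \<alpha> \<beta> :: 'a
  assumes step: "\<bar>X i (Suc t) - X i t\<bar> \<le> 1"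
    and inj: "X i t = X j t \<Longrightarrow> i = j"
    and swap_right: "X i (Suc t) = X i t + 1 \<Longrightarrow> \<exists>j. X j t = X i t + 1 \<and> X j (Suc t) = X i t"
    and swap_left: "X i (Suc t) = X i t - 1 \<Longrightarrow> \<exists>j. X j t = X i t - 1 \<and> X j (Suc t) = X i t"
    and stop: "N \<le> t \<Longrightarrow> X i t = X i N"
    and fixed: "i \<notin> M \<Longrightarrow> i \<noteq> \<alpha> \<Longrightarrow> i \<noteq> \<beta> \<Longrightarrow> X i (Suc t) = X i t"
    and \<alpha>_right: "X \<alpha> t \<le> X \<alpha> (Suc t)"
    and \<beta>_left: "X \<beta> (Suc t) \<le> X \<beta> t"
    and start: "m \<in> M \<Longrightarrow> X \<alpha> 0 < X m 0 \<and> X m 0 < X \<beta> 0"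
    and finish: "m \<in> M \<Longrightarrow> X \<beta> N < X m N \<and> X m N < X \<alpha> N"
    and two_moves: "m \<in> M \<Longrightarrow> e \<in> {1, -1} \<Longrightarrow> s \<le> t \<Longrightarrow> t \<le> r \<Longrightarrow> X m (Suc s) = X m s + e \<Longrightarrow>
      X m (Suc r) = X m r + e \<Longrightarrow> X m (Suc v) = X m v - e \<Longrightarrow> X m (Suc t) = X m t + e"
begin

lemma mirror: "two_move_paths (\<lambda>i t. - X i t) N M \<beta> \<alpha>"
proof
  show "\<bar>- X i (Suc t) - - X i t\<bar> \<le> 1" for i t
    using step[of i t] by linarith
  show "\<exists>j. - X j t = - X i t + 1 \<and> - X j (Suc t) = - X i t"
    if "- X i (Suc t) = - X i t + 1" for i t
  proof -
    have "X i (Suc t) = X i t - 1"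
      using that by linarith
    from swap_left[OF this] show ?thesis
      by force
  qed
  show "\<exists>j. - X j t = - X i t - 1 \<and> - X j (Suc t) = - X i t"
    if "- X i (Suc t) = - X i t - 1" for i t
  proof -
    have "X i (Suc t) = X i t + 1"
      using that by linarith
    from swap_right[OF this] show ?thesis
      by force
  qed
  show "- X m (Suc t) = - X m t + e"
    if "m \<in> M" "e \<in> {1, -1}" "s \<le> t" "t \<le> r" "- X m (Suc s) = - X m s + e"
      "- X m (Suc r) = - X m r + e" "- X m (Suc v) = - X m v - e" for m e s t r v
  proof -
    have "- e \<in> {1, -1}"
      using that by auto
    then show ?thesis
      using two_moves[of m "-e" s t r v] that by simp
  qed
  show "- X i t = - X i N" if "N \<le> t" for i t
    using stop[OF that] by simp
qed (use inj fixed \<alpha>_right \<beta>_left start finish in auto)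

section \<open>Crossings of two paths\<close>

text \<open>The difference of the positions drops from at least 1 to at most -1, while each position
  changes by at most 1, so all these bounds are attained.\<close>

lemma cross:
  assumes "X i t < X j t" "X j (Suc t) < X i (Suc t)"
  shows "X i (Suc t) = X i t + 1" "X j (Suc t) = X j t - 1" "X j t = X i t + 1"
  using assms step[of i t] step[of j t] by linarith+

lemma cross_exists:
  assumes "s \<le> r" "X i s < X j s" "X j r < X i r"
  obtains t where "s \<le> t" "t < r" "X i t < X j t" "X j (Suc t) < X i (Suc t)"
proof -
  have "X i r < X j r" if *: "\<And>t. s \<le> t \<Longrightarrow> t < r \<Longrightarrow> X i t < X j t \<Longrightarrow> \<not> X j (Suc t) < X i (Suc t)"
    using \<open>s \<le> r\<close> *
  proof (induction r rule: dec_induct)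
    case base
    show ?case by fact
  next
    case (step k)
    then have "X i k < X j k" "\<not> X j (Suc k) < X i (Suc k)"
      by auto
    moreover have "i \<noteq> j"
      using \<open>X i s < X j s\<close> by auto
    ultimately show ?case
      using inj[of i "Suc k" j] by force
  qed
  then show ?thesis
    using assms that by force
qed

text \<open>Overtaking \<alpha> would, by \<open>cross\<close>, make \<alpha> step left.\<close>

lemma behind_\<alpha>:
  assumes "X i s < X \<alpha> s" "s \<le> r"
  shows "X i r < X \<alpha> r"
proof (rule ccontr)
  assume "\<not> ?thesis"
  then have "X \<alpha> r < X i r"
    using inj[of i r \<alpha>] assms(1) by force
  then obtain t where "X i t < X \<alpha> t" "X \<alpha> (Suc t) < X i (Suc t)"
    using cross_exists assms by metis
  from cross(2)[OF this] show False
    using \<alpha>_right[of t] by simp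
qed

lemma \<alpha>_cross:
  assumes "m \<in> M"
  obtains t where "X \<alpha> t < X m t" "X m (Suc t) < X \<alpha> (Suc t)"
    "X m (Suc t) = X m t - 1" "X \<alpha> (Suc t) = X m t"
proof -
  obtain t where t: "X \<alpha> t < X m t" "X m (Suc t) < X \<alpha> (Suc t)"
    using cross_exists[of 0 N \<alpha> m] start[OF assms] finish[OF assms] by auto
  then show ?thesis
    using that[of t] cross[OF t] by simp
qed

lemma \<beta>_cross:
  assumes "m \<in> M"
  obtains t where "X m t < X \<beta> t" "X \<beta> (Suc t) < X m (Suc t)" "X m (Suc t) = X m t + 1"
proof -
  obtain t where t: "X m t < X \<beta> t" "X \<beta> (Suc t) < X m (Suc t)"
    using cross_exists[of 0 N m \<beta>] start[OF assms] finish[OF assms] by auto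
  then show ?thesis
    using that[of t] cross[OF t] by simp
qed

text \<open>This runs backwards in time: an element to the right of \<beta> stays there, since
  falling behind would make \<beta> step right.\<close>

lemma behind_\<beta>:
  assumes "X i r < X \<beta> r" "i \<noteq> \<beta>" "s \<le> r"
  shows "X i s < X \<beta> s"
proof (rule ccontr)
  assume "\<not> ?thesis"
  then have "X \<beta> s < X i s"
    using inj[of i s \<beta>] assms(2) by force
  then obtain t where "X \<beta> t < X i t" "X i (Suc t) < X \<beta> (Suc t)"
    using cross_exists assms by metis
  from cross(1)[OF this] show False
    using \<beta>_left[of t] by simp
qed

section \<open>Left-first and right-first elements\<close>

definition left_first :: "'a \<Rightarrow> bool" where
  "left_first m \<longleftrightarrow> (\<forall>s t. X m (Suc s) = X m s - 1 \<and> X m (Suc t) = X m t + 1 \<longrightarrow> s < t)"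

definition right_first :: "'a \<Rightarrow> bool" where
  "right_first m \<longleftrightarrow> (\<forall>s t. X m (Suc s) = X m s - 1 \<and> X m (Suc t) = X m t + 1 \<longrightarrow> t < s)"

text \<open>Since \<open>m\<close> also steps right, when it crosses \<beta>,
  \<open>two_moves\<close> allows no gap among its left steps.\<close>

lemma left_solid:
  assumes "m \<in> M" "X m (Suc s) = X m s - 1" "X m (Suc r) = X m r - 1" "s \<le> t" "t \<le> r"
  shows "X m (Suc t) = X m t - 1"
proof -
  obtain v where "X m (Suc v) = X m v + 1"
    using \<beta>_cross[OF assms(1)] .
  then show ?thesis
    using two_moves[of m "-1" s t r v] assms by simp
qed

lemma right_solid:
  assumes "m \<in> M" "X m (Suc s) = X m s + 1" "X m (Suc r) = X m r + 1" "s \<le> t" "t \<le> r"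
  shows "X m (Suc t) = X m t + 1"
proof -
  obtain v where "X m (Suc v) = X m v - 1"
    using \<alpha>_cross[OF assms(1)] .
  then show ?thesis
    using two_moves[of m 1 s t r v] assms by simp
qed

text \<open>If both fail, some right step precedes a left step and some left step precedes a right
  step. Then a right step lies between two left steps or vice versa, against solidity.\<close>

lemma left_or_right_first:
  assumes m: "m \<in> M"
  shows "left_first m \<or> right_first m"
proof (rule ccontr)
  assume "\<not> ?thesis"
  then obtain s t s' t' where *: "X m (Suc s) = X m s - 1" "X m (Suc t) = X m t + 1" "t \<le> s"
    "X m (Suc s') = X m s' - 1" "X m (Suc t') = X m t' + 1" "s' \<le> t'"
    by (auto simp: left_first_def right_first_def not_less)
  show False
  proof (cases "s' \<le> t")
    case True
    then show False
      using left_solid[OF m *(4,1), of t] * by simp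
  next
    case False
    then show False
      using right_solid[OF m *(2,5), of s'] * by simp
  qed
qed

text \<open>Otherwise \<open>u\<close> overtakes \<open>f\<close> by a right step and later falls
  back by a left step.\<close>

lemma left_first_behind:
  assumes "left_first u" "X u s < X f s" "X u N < X f N" "s \<le> r"
  shows "X u r < X f r"
proof (rule ccontr)
  assume "\<not> ?thesis"
  moreover have "u \<noteq> f"
    using assms by auto
  ultimately have "X f r < X u r"
    using inj[of u r f] by force
  then have "r \<le> N"
    using stop[of r u] stop[of r f] assms(3) by (cases "r \<le> N") auto
  obtain t where t: "t < r" "X u t < X f t" "X f (Suc t) < X u (Suc t)"
    using cross_exists[OF \<open>s \<le> r\<close> assms(2) \<open>X f r < X u r\<close>] by blast
  obtain t' where t': "r \<le> t'" "X f t' < X u t'" "X u (Suc t') < X f (Suc t')"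
    using cross_exists[OF \<open>r \<le> N\<close> \<open>X f r < X u r\<close> assms(3)] by blast
  have "t' < t"
    using \<open>left_first u\<close> cross(2)[OF t'(2,3)] cross(1)[OF t(2,3)] by (auto simp: left_first_def)
  then show False
    using t(1) t'(1) by simp
qed

section \<open>The forbidden configuration\<close>

text \<open>\<open>f_last\<close> covers all candidates \<open>u\<close>, since it is not known in
  advance which element \<open>y\<close> meets right after \<alpha>.\<close>

lemma left_first_inversion_last:
  assumes M: "x \<in> M" "y \<in> M" "f \<in> M"
    and left_first: "left_first x" "left_first y" "left_first f"
    and inversion: "X x 0 < X y 0" "X y N < X x N"
    and "X y 0 < X f 0"
    and f_last: "\<And>u. u \<in> M \<Longrightarrow> X u 0 < X y 0 \<Longrightarrow> X y N < X u N \<Longrightarrow> X u N < X f N"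
  shows False
proof -
  have distinct: "\<alpha> \<noteq> x" "\<alpha> \<noteq> y"
    using start[OF M(1)] start[OF M(2)] by auto
  obtain s where s: "X x s < X y s" "X y (Suc s) < X x (Suc s)"
    using cross_exists[of 0 N x y] inversion by auto
  obtain t where t: "X \<alpha> t < X y t" "X y (Suc t) < X \<alpha> (Suc t)"
    "X y (Suc t) = X y t - 1" "X \<alpha> (Suc t) = X y t"
    using \<alpha>_cross[OF M(2)] .
  \<comment> \<open>\<open>x\<close> crosses \<alpha> before its right step at \<open>s\<close>, so
    at time \<open>s\<close> it is left of \<alpha>, and so is its neighbour
    \<open>y\<close>.\<close>
  have "t < s"
  proof -
    obtain r where r: "X x (Suc r) < X \<alpha> (Suc r)" "X x (Suc r) = X x r - 1"
      using \<alpha>_cross[OF M(1)] by metis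
    have "Suc r \<le> s"
      using left_first(1) r(2) cross(1)[OF s] by (auto simp: left_first_def Suc_le_eq)
    then have "X x s < X \<alpha> s"
      using behind_\<alpha>[OF r(1)] by simp
    then have "X y s < X \<alpha> s"
      using cross(3)[OF s] inj[of y s \<alpha>] distinct by force
    then show ?thesis
      using behind_\<alpha>[of y s t] t(1) by fastforce
  qed
  have "X y (Suc (Suc t)) = X y (Suc t) - 1"
    using left_solid[OF M(2) t(3) cross(2)[OF s], of "Suc t"] \<open>t < s\<close> by simp
  from swap_left[OF this] obtain u
    where u: "X u (Suc t) = X y (Suc t) - 1" "X u (Suc (Suc t)) = X y (Suc t)"
    by auto
  have u_right: "X u (Suc (Suc t)) = X u (Suc t) + 1"
    using u by simp
  have "u \<noteq> \<alpha>"
    using u t by auto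
  have "u \<noteq> \<beta>"
    using u_right \<beta>_left[of "Suc t"] by auto
  have "u \<in> M"
    using fixed[of u "Suc t"] u_right \<open>u \<noteq> \<alpha>\<close> \<open>u \<noteq> \<beta>\<close> by auto
  \<comment> \<open>Otherwise \<open>u\<close> has not yet crossed \<open>\<alpha>\<close>, which however is already to the right of \<open>y\<close>.\<close>
  have "left_first u"
  proof (rule ccontr)
    assume "\<not> left_first u"
    then have "right_first u"
      using left_or_right_first[OF \<open>u \<in> M\<close>] by simp
    obtain r where r: "X \<alpha> r < X u r" "X u (Suc r) = X u r - 1"
      using \<alpha>_cross[OF \<open>u \<in> M\<close>] by metis
    have "Suc t < r"
      using \<open>right_first u\<close> r(2) u_right by (auto simp: right_first_def)
    moreover have "X u (Suc t) < X \<alpha> (Suc t)"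
      using u t by simp
    ultimately show False
      using behind_\<alpha>[of u "Suc t" r] r(1) by simp
  qed
  \<comment> \<open>Otherwise \<open>y\<close> steps right past \<open>u\<close> no later than its
    left step at \<open>t\<close>.\<close>
  have "X u 0 < X y 0"
  proof (rule ccontr)
    assume "\<not> ?thesis"
    then have "X y 0 < X u 0"
      using inj[of u 0 y] u(1) by force
    then obtain r where r: "r < Suc t" "X y r < X u r" "X u (Suc r) < X y (Suc r)"
      using cross_exists[of 0 "Suc t" y u] u(1) by auto
    have "t < r"
      using left_first(2) t(3) cross(1)[OF r(2,3)] unfolding left_first_def by blast
    then show False
      using r(1) by simp
  qed
  obtain T where T: "X \<alpha> T < X f T" "X f (Suc T) < X \<alpha> (Suc T)"
    "X f (Suc T) = X f T - 1" "X \<alpha> (Suc T) = X f T"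
    using \<alpha>_cross[OF M(3)] .
  \<comment> \<open>A left-first \<open>u\<close> that starts and ends left of \<open>y\<close>
    would never get to its right.\<close>
  have "X y N < X u N"
  proof (rule ccontr)
    assume "\<not> ?thesis"
    then have "X u N < X y N"
      using inj[of u N y] u(1) by force
    from left_first_behind[OF \<open>left_first u\<close> \<open>X u 0 < X y 0\<close> this, of "Suc (Suc t)"]
    show False
      using u(2) \<open>X y (Suc (Suc t)) = X y (Suc t) - 1\<close> by simp
  qed
  then have "X u N < X f N"
    using f_last \<open>u \<in> M\<close> \<open>X u 0 < X y 0\<close> by blast
  have u_behind_f: "X u r < X f r" for r
    using left_first_behind[OF \<open>left_first u\<close> _ \<open>X u N < X f N\<close>, of 0 r]
      \<open>X u 0 < X y 0\<close> \<open>X y 0 < X f 0\<close> by simp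
  have y_behind_f: "X y r < X f r" for r
    using left_first_behind[OF left_first(2), of 0 f r] \<open>X y 0 < X f 0\<close>
      \<open>X y N < X u N\<close> \<open>X u N < X f N\<close> by simp
  \<comment> \<open>At time \<open>Suc t\<close>, \<alpha> is immediately right of \<open>y\<close>,
    which leaves no room for \<open>f\<close> between them.\<close>
  have "t < T"
  proof (rule ccontr)
    assume "\<not> ?thesis"
    then have "X f (Suc t) < X \<alpha> (Suc t)"
      using behind_\<alpha>[OF T(2), of "Suc t"] by simp
    then show False
      using y_behind_f[of "Suc t"] t(3,4) by simp
  qed
  \<comment> \<open>\<open>f\<close> crosses \<beta> only after its left step at \<open>T\<close>,
    and \<open>u\<close> is behind \<open>f\<close>. Hence the right move of \<open>u\<close> lasts
    beyond time \<open>T\<close>.\<close>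
  have "X u (Suc T) < X \<beta> (Suc T)"
  proof -
    obtain r where r: "X f r < X \<beta> r" "X f (Suc r) = X f r + 1"
      using \<beta>_cross[OF M(3)] by metis
    have "Suc T \<le> r"
      using left_first(3) T(3) r(2) by (auto simp: left_first_def Suc_le_eq)
    moreover have "f \<noteq> \<beta>"
      using r(1) by auto
    ultimately have "X f (Suc T) < X \<beta> (Suc T)"
      using behind_\<beta>[OF r(1)] by simp
    then show ?thesis
      using u_behind_f[of "Suc T"] by simp
  qed
  obtain r where r: "X \<beta> (Suc r) < X u (Suc r)" "X u (Suc r) = X u r + 1"
    using \<beta>_cross[OF \<open>u \<in> M\<close>] by metis
  have "Suc T \<le> r"
  proof (rule ccontr)
    assume "\<not> ?thesis"
    then have "X u (Suc r) < X \<beta> (Suc r)"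
      using behind_\<beta>[OF \<open>X u (Suc T) < X \<beta> (Suc T)\<close> \<open>u \<noteq> \<beta>\<close>, of "Suc r"] by simp
    then show False
      using r(1) by simp
  qed
  then have u_solid: "X u (Suc \<tau>) = X u \<tau> + 1" if "Suc t \<le> \<tau>" "\<tau> \<le> Suc T" for \<tau>
    using right_solid[OF \<open>u \<in> M\<close> u_right r(2), of \<tau>] that by simp
  have u_pos: "X u (Suc t + k) = X u (Suc t) + int k" if "k \<le> T - t" for k
    using that
  proof (induction k)
    case (Suc k)
    then show ?case
      using u_solid[of "Suc t + k"] by simp
  qed simp
  have \<alpha>_pos: "X \<alpha> (Suc t + k) \<le> X \<alpha> (Suc t) + int k" for k
  proof (induction k)
    case (Suc k)
    then show ?case
      using step[of \<alpha> "Suc t + k"] by simp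
  qed simp
  \<comment> \<open>At time \<open>Suc t\<close>, \<alpha> is two places ahead of \<open>u\<close>,
    and this lead cannot grow because \<open>u\<close> does not pause. As \<open>f\<close> is just
    left of \<alpha> at time \<open>Suc T\<close>, it is next to \<open>u\<close>.\<close>
  have "X \<alpha> (Suc T) \<le> X u (Suc T) + 2"
    using u_pos[of "T - t"] \<alpha>_pos[of "T - t"] \<open>t < T\<close> u(1) t(3,4) by simp
  then have f_pos: "X f (Suc T) = X u (Suc T) + 1"
    using u_behind_f[of "Suc T"] T(3,4) by simp
  \<comment> \<open>The next right step of \<open>u\<close> would swap it with \<open>f\<close>,
    which it never passes.\<close>
  obtain j where j: "X j (Suc T) = X u (Suc T) + 1" "X j (Suc (Suc T)) = X u (Suc T)"
    using swap_right[OF u_solid[of "Suc T"]] \<open>t < T\<close> by auto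
  then have "j = f"
    using inj[of j "Suc T" f] f_pos by simp
  then show False
    using u_behind_f[of "Suc (Suc T)"] u_solid[of "Suc T"] j(2) \<open>t < T\<close> by simp
qed

end

section \<open>The obstruction\<close>

text \<open>For \<open>n > 8\<close>, each of the blocks {1, n}, {2, 3}, {4..n - 3}, {n - 2, n - 1}
  is reversed within itself. The result is an involution, so it is also the map from elements to
  final positions.\<close>

definition obstruction :: "nat \<Rightarrow> nat \<Rightarrow> nat" where
  "obstruction n i =
     (if i \<in> {2, 3} then 5 - i
      else if i \<in> {n - 2, n - 1} then 2 * n - 3 - i
      else if i \<in> {1..n} then n + 1 - i
      else i)"

lemma obstruction_involution:
  assumes "n > 8"
  shows "obstruction n (obstruction n i) = i"
proof -
  consider "i \<in> {2, 3}" | "i \<in> {n - 2, n - 1}" | "i \<in> insert 1 (insert n {4..n - 3})" | "i \<notin> {1..n}"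
    by fastforce
  then show ?thesis
  proof cases
    case 1
    then show ?thesis
      by (auto simp: obstruction_def)
  next
    case 2
    let ?j = "2 * n - 3 - i"
    have "obstruction n k = 2 * n - 3 - k" if "k \<in> {n - 2, n - 1}" for k
      using that assms by (auto simp: obstruction_def)
    moreover have "?j \<in> {n - 2, n - 1}" "2 * n - 3 - ?j = i"
      using 2 assms by auto
    ultimately show ?thesis
      using 2 by metis
  next
    case 3
    have "obstruction n k = n + 1 - k" if "k \<in> insert 1 (insert n {4..n - 3})" for k
    proof -
      have "k \<notin> {2, 3}" "k \<notin> {n - 2, n - 1}" "k \<in> {1..n}"
        using that assms by auto
      then show ?thesis
        by (simp only: obstruction_def if_True if_False)
    qed
    moreover have "n + 1 - i \<in> insert 1 (insert n {4..n - 3})" "n + 1 - (n + 1 - i) = i"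
      using 3 assms by auto
    ultimately show ?thesis
      using 3 by metis
  next
    case 4
    then have "obstruction n i = i"
      using assms by (auto simp: obstruction_def)
    then show ?thesis
      by simp
  qed
qed

lemma obstruction_permutes:
  assumes "n > 8"
  shows "obstruction n permutes {1..n}"
proof (rule bij_imp_permutes)
  have "obstruction n ` {1..n} \<subseteq> {1..n}"
    using assms by (auto simp: obstruction_def)
  then show "bij_betw (obstruction n) {1..n} {1..n}"
    using obstruction_involution[OF assms] by (intro bij_betw_byWitness[where f' = "obstruction n"]) auto
  show "obstruction n i = i" if "i \<notin> {1..n}" for i
    using that assms by (auto simp: obstruction_def)
qed

lemma position_obstruction:
  assumes "n > 8"
  shows "position (obstruction n) i = int (obstruction n i)"
proof -
  have "inv (obstruction n) = obstruction n"
    by (rule inv_equality) (simp_all add: obstruction_involution[OF assms])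
  then show ?thesis
    by (simp add: position_def)
qed

section \<open>Contradictory types for the obstruction\<close>

lemma no_two_move_obstruction:
  assumes "n > 8" and "two_move_paths X N {2..n - 1} 1 n"
    and first: "\<And>i. X i 0 = int i" and last: "\<And>i. X i N = int (obstruction n i)"
  shows False
proof -
  interpret two_move_paths X N "{2..n - 1}" 1 n
    by fact
  interpret mirror: two_move_paths "\<lambda>i t. - X i t" N "{2..n - 1}" n 1
    by (rule mirror)
  have mirror_left_first: "mirror.left_first i \<longleftrightarrow> right_first i" for i
    by (auto simp: mirror.left_first_def right_first_def)
  have left: "\<not> left_first f"
    if "left_first x" "left_first y" "x < y" "x \<in> {2..n - 1}" "y \<in> {2..n - 1}" "f \<in> {2..n - 1}"
      "y < f" "obstruction n y < obstruction n x"
      "\<And>u. u \<in> {2..n - 1} \<Longrightarrow> u < y \<Longrightarrow> obstruction n y < obstruction n u \<Longrightarrow>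
        obstruction n u < obstruction n f" for x y f
    using left_first_inversion_last[of x y f] that by (auto simp: first last)
  \<comment> \<open>Negation reverses the order, so \<open>x\<close> and \<open>y\<close> exchange
    roles and \<open>f\<close> starts and ends to the left of their block.\<close>
  have right: "\<not> right_first f"
    if "right_first x" "right_first y" "x < y" "x \<in> {2..n - 1}" "y \<in> {2..n - 1}" "f \<in> {2..n - 1}"
      "f < x" "obstruction n y < obstruction n x"
      "\<And>u. u \<in> {2..n - 1} \<Longrightarrow> x < u \<Longrightarrow> obstruction n u < obstruction n x \<Longrightarrow>
        obstruction n f < obstruction n u" for x y f
    using mirror.left_first_inversion_last[of y x f] that
    by (auto simp: first last mirror_left_first)
  have either: "left_first i \<or> right_first i" if "i \<in> {2..n - 1}" for i
    using left_or_right_first that by blast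
  have ends: "2 \<in> {2..n - 1}" "3 \<in> {2..n - 1}" "n - 2 \<in> {2..n - 1}" "n - 1 \<in> {2..n - 1}"
    using assms(1) by auto
  have vals: "obstruction n 2 = 3" "obstruction n 3 = 2"
    "obstruction n (n - 2) = n - 1" "obstruction n (n - 1) = n - 2"
    using assms(1) by (auto simp: obstruction_def)
  have middle: "obstruction n i = n + 1 - i" if "4 \<le> i" "i \<le> 6" for i
    using that assms(1) by (auto simp: obstruction_def)
  have upper: "obstruction n i \<le> n - 3" if "2 \<le> i" "i \<le> n - 3" for i
    using that assms(1) by (auto simp: obstruction_def)
  have lower: "4 \<le> obstruction n i" if "4 \<le> i" "i \<le> n - 1" for i
    using that assms(1) by (auto simp: obstruction_def)
  \<comment> \<open>Only 2 starts left of 3 within {2..n - 1}, and \<open>f\<close> ends to the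
    right of both.\<close>
  have left_pair: "\<not> left_first f"
    if l: "left_first 2" "left_first 3" and f: "4 \<le> f" "f \<le> n - 1" for f
  proof (rule left[OF l])
    show "obstruction n u < obstruction n f" if "u \<in> {2..n - 1}" "u < 3" for u
    proof -
      have "u = 2"
        using that by auto
      then show ?thesis
        using lower[OF f] vals by simp
    qed
    show "obstruction n 3 < obstruction n 2"
      using vals by simp
  qed (use f in auto)
  have right_pair: "\<not> right_first f"
    if r: "right_first (n - 2)" "right_first (n - 1)" and f: "2 \<le> f" "f \<le> n - 3" for f
  proof (rule right[OF r])
    show "obstruction n f < obstruction n u" if "u \<in> {2..n - 1}" "n - 2 < u" for u
    proof -
      have "u = n - 1"
        using that by auto
      then show ?thesis
        using upper[OF f] vals assms(1) by simp
    qed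
    show "obstruction n (n - 1) < obstruction n (n - 2)"
      using vals assms(1) by simp
  qed (use f assms(1) in auto)
  \<comment> \<open>Pigeonhole: as \<open>n > 8\<close>, the block {4..n - 3} contains 4, 5 and 6,
    and any two of them are inverted.\<close>
  have "left_first 4 \<or> right_first 4" "left_first 5 \<or> right_first 5" "left_first 6 \<or> right_first 6"
    using either assms(1) by auto
  then consider "left_first 4" "left_first 5" | "left_first 4" "left_first 6" | "left_first 5" "left_first 6"
    | "right_first 4" "right_first 5" | "right_first 4" "right_first 6" | "right_first 5" "right_first 6"
    by blast
  then obtain x y where xy: "4 \<le> x" "x < y" "y \<le> 6"
    and "left_first x \<and> left_first y \<or> right_first x \<and> right_first y"
    by cases (use that[of 4 5] that[of 4 6] that[of 5 6] in simp_all)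
  then consider "left_first x" "left_first y" | "right_first x" "right_first y"
    by blast
  then show False
  proof cases
    case 1
    \<comment> \<open>Every \<open>u\<close> starting left of \<open>y\<close> is at most
      \<open>n - 3\<close>, so it ends at \<open>n - 3\<close> or earlier, left of
      \<open>f\<close>.\<close>
    have "\<not> left_first f" if "f \<in> {n - 2, n - 1}" for f
    proof (rule left[OF 1])
      show "obstruction n u < obstruction n f" if "u \<in> {2..n - 1}" "u < y" for u
      proof -
        have "obstruction n u \<le> n - 3"
          using upper[of u] that xy assms(1) by simp
        then show ?thesis
          using \<open>f \<in> {n - 2, n - 1}\<close> vals assms(1) by auto
      qed
      show "obstruction n y < obstruction n x"
        using middle[of x] middle[of y] xy assms(1) by simp
    qed (use that xy assms(1) in auto)
    then have r: "right_first (n - 2)" "right_first (n - 1)"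
      using either[OF ends(3)] either[OF ends(4)] by auto
    then have l: "left_first 2" "left_first 3"
      using right_pair[OF r] either[OF ends(1)] either[OF ends(2)] assms(1) by auto
    have "\<not> left_first x"
      using left_pair[OF l] xy assms(1) by auto
    then show False
      using 1 by simp
  next
    case 2
    have "\<not> right_first f" if "f \<in> {2, 3}" for f
    proof (rule right[OF 2])
      show "obstruction n f < obstruction n u" if "u \<in> {2..n - 1}" "x < u" for u
      proof -
        have "4 \<le> obstruction n u"
          using lower[of u] that xy by simp
        then show ?thesis
          using \<open>f \<in> {2, 3}\<close> vals by auto
      qed
      show "obstruction n y < obstruction n x"
        using middle[of x] middle[of y] xy assms(1) by simp
    qed (use that xy assms(1) in auto)
    then have l: "left_first 2" "left_first 3"
      using either[OF ends(1)] either[OF ends(2)] by auto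
    then have r: "right_first (n - 2)" "right_first (n - 1)"
      using left_pair[OF l, of "n - 2"] left_pair[OF l, of "n - 1"] either[OF ends(3)] either[OF ends(4)]
        assms(1) by auto
    have "\<not> right_first x"
      using right_pair[OF r] xy assms(1) by auto
    then show False
      using 2 by simp
  qed
qed

section \<open>From tangles to systems of two-move paths\<close>

theorem proposition17:
  fixes n :: nat
  assumes "n > 8"
  shows "\<exists>\<pi>. \<pi> permutes {1..n} \<and>
           (\<forall>T. tangle n T \<and> performs T \<pi> \<longrightarrow> (\<exists>i\<in>{1..n}. card (moves (path T i)) \<ge> 3))"
proof (intro exI conjI allI impI)
  show "obstruction n permutes {1..n}"
    using assms by (rule obstruction_permutes)
next
  fix T
  assume T: "tangle n T \<and> performs T (obstruction n)"
  show "\<exists>i\<in>{1..n}. card (moves (path T i)) \<ge> 3"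
  proof (rule ccontr)
    assume "\<not> ?thesis"
    then have few: "card (moves (path T i)) < 3" if "i \<in> {1..n}" for i
      using that by (simp add: not_le)
    define N where "N = length T - 1"
    have len: "length T = Suc N"
      using T by (auto simp: N_def tangle_def)
    define X where "X i t = position (T ! min t N) i" for i t
    have perm: "T ! min t N permutes {1..n}" for t
      using T len by (auto simp: tangle_def)
    have later: "X i (Suc t) = X i t" if "N \<le> t" for i t
      using that by (simp add: X_def)
    have adj: "adjacent n (T ! min t N) (T ! min (Suc t) N)" for t
    proof (cases "t < N")
      case True
      then show ?thesis
        using T len successively_nth[of "adjacent n" T t] by (simp add: tangle_def)
    qed (simp add: adjacent_def)
    have first: "X i 0 = int i" for i
      using T by (simp add: X_def performs_def position_def hd_conv_nth[symmetric])
    have last: "X i N = int (obstruction n i)" for i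
    proof -
      have "T ! N = obstruction n"
        using T last_conv_nth[of T] by (simp add: performs_def N_def)
      then show ?thesis
        using assms by (simp add: X_def position_obstruction)
    qed
    have bounds: "1 \<le> X i t" "X i t \<le> int n" if "i \<in> {1..n}" for i t
      using position_bounds[OF perm that] by (simp_all add: X_def)
    have two_moves: "X i (Suc t) = X i t + e"
      if "i \<in> {1..n}" "e \<in> {1, -1}" "s \<le> t" "t \<le> r" "X i (Suc s) = X i s + e"
        "X i (Suc r) = X i r + e" "X i (Suc v) = X i v - e" for i e s t r v
    proof (rule ccontr)
      assume neq: "\<not> ?thesis"
      have "s \<noteq> t" "t \<noteq> r"
        using neq that by auto
      \<comment> \<open>From time \<open>N\<close> on nothing moves, so these steps lie within the
        tangle, as \<open>three_moves\<close> requires.\<close>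
      moreover have "r < N" "v < N"
        using later[of r i] later[of v i] that by (force simp: not_le[symmetric])+
      moreover have "path T i ! k = X i k" if "k \<le> N" for k
        using that len by (simp add: path_def X_def)
      ultimately have "card (moves (path T i)) \<ge> 3"
        using three_moves[of s t r "path T i" v e] neq that len by (simp add: path_def)
      then show False
        using few[OF that(1)] by simp
    qed
    have step: "\<bar>X i (Suc t) - X i t\<bar> \<le> 1" for i t
      using adjacent_step[OF perm perm adj] by (simp add: X_def)
    have "two_move_paths X N {2..n - 1} 1 n"
    proof
      show "\<bar>X i (Suc t) - X i t\<bar> \<le> 1" for i t
        by (rule step)
      show "i = j" if "X i t = X j t" for i j t
        using position_inj[OF perm] that by (simp add: X_def)
      show "\<exists>j. X j t = X i t + 1 \<and> X j (Suc t) = X i t" if "X i (Suc t) = X i t + 1" for i t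
        using adjacent_swap[OF perm perm adj] that by (metis X_def)
      show "\<exists>j. X j t = X i t - 1 \<and> X j (Suc t) = X i t" if "X i (Suc t) = X i t - 1" for i t
      proof -
        have "X i t = X i (Suc t) + 1"
          using that by simp
        then obtain j where "X j (Suc t) = X i (Suc t) + 1" "X j t = X i (Suc t)"
          using adjacent_swap[OF perm perm adjacent_sym[OF adj]] by (metis X_def)
        then show ?thesis
          using that by auto
      qed
      show "X i t = X i N" if "N \<le> t" for i t
        using that by (simp add: X_def)
      show "X i (Suc t) = X i t" if "i \<notin> {2..n - 1}" "i \<noteq> 1" "i \<noteq> n" for i t
      proof -
        have "i \<notin> {1..n}"
          using that by auto
        then show ?thesis
          using position_fixed[OF perm] by (simp add: X_def)
      qed
      show "X 1 t \<le> X 1 (Suc t)" for t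
      proof (rule ccontr)
        assume "\<not> ?thesis"
        then have t: "X 1 (Suc t) = X 1 t - 1"
          using step[of 1 t] by linarith
        then have "t < N"
          using later[of t 1] by (cases "t < N") auto
        \<comment> \<open>Path 1 starts at the leftmost position and ends at the rightmost, so a
          left step has right steps both before and after it, contradicting
          \<open>two_moves\<close>.\<close>
        have "X 1 0 < X 1 t" "X 1 (Suc t) < X 1 N"
          using bounds[of 1 "Suc t"] bounds[of 1 t] t first[of 1] last[of 1] assms
          by (auto simp: obstruction_def)
        then obtain s r where "s < t" "X 1 (Suc s) = X 1 s + 1" "Suc t \<le> r" "X 1 (Suc r) = X 1 r + 1"
          using increasing_step_exists[of "X 1" 0 t] increasing_step_exists[of "X 1" "Suc t" N] step
            \<open>t < N\<close> by (metis Suc_leI le0)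
        then show False
          using two_moves[of 1 1 s t r t] t assms by simp
      qed
      show "X n (Suc t) \<le> X n t" for t
      proof (rule ccontr)
        assume "\<not> ?thesis"
        then have t: "X n (Suc t) = X n t + 1"
          using step[of n t] by linarith
        then have "t < N"
          using later[of t n] by (cases "t < N") auto
        \<comment> \<open>The argument for path 1 with positions negated.\<close>
        have "- X n 0 < - X n t" "- X n (Suc t) < - X n N"
          using bounds[of n "Suc t"] bounds[of n t] t first[of n] last[of n] assms
          by (auto simp: obstruction_def)
        moreover have "\<bar>- X n (Suc k) - - X n k\<bar> \<le> 1" for k
          using step[of n k] by linarith
        ultimately obtain s r where "s < t" "- X n (Suc s) = - X n s + 1"
          "Suc t \<le> r" "- X n (Suc r) = - X n r + 1"
          using increasing_step_exists[of "\<lambda>t. - X n t" 0 t]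
            increasing_step_exists[of "\<lambda>t. - X n t" "Suc t" N] \<open>t < N\<close> by (metis Suc_leI le0)
        then show False
          using two_moves[of n "-1" s t r t] t assms by simp
      qed
      show "X 1 0 < X m 0 \<and> X m 0 < X n 0" if "m \<in> {2..n - 1}" for m
        using that by (auto simp: first)
      show "X n N < X m N \<and> X m N < X 1 N" if "m \<in> {2..n - 1}" for m
        using that assms by (auto simp: last obstruction_def)
      show "X m (Suc t) = X m t + e"
        if "m \<in> {2..n - 1}" "e \<in> {1, -1}" "s \<le> t" "t \<le> r" "X m (Suc s) = X m s + e"
          "X m (Suc r) = X m r + e" "X m (Suc v) = X m v - e" for m e s t r v
        using two_moves[OF _ that(2-)] that(1) by auto
    qed
    then show False
      using no_two_move_obstruction[OF assms _ first last] by simp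
  qed
qed

end
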